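(* Let $\{E_\lambda:\lambda\in\Lambda\}$ be a family of real Banach spaces and let $E=[\bigoplus_{\lambda\in\Lambda}E_\lambda]_F$ where $F$ is one of $c_0$, $\ell_\infty$ or $\ell_1$. Then $E$ has the property $( ** )$ if and only if each $E_\lambda$ has the property $( ** )$.
   Context: All Banach spaces are real. For a Banach space $Z$, $B_Z$, $S_Z$ and $Z^*$ denote its closed unit ball, unit sphere and dual. For $z^*\in S_{Z^*}$ and $0<\alpha<1$, the slice is $S(z^*,\alpha)=\{z\in B_Z: z^*(z)>1-\alpha\}$, and $-S(z^*,\alpha)=\{-z: z\in S(z^*,\alpha)\}$. A Banach space $Z$ has the property $( ** )$ if for all $z_1,z_2\in S_Z$ and every $\varepsilon>0$ there exists $z^*\in S_{Z^*}$ such that, writing $S=S(z^*,\varepsilon)$, one has $z_1\in S$ and $\operatorname{dist}(z_2,S)+\operatorname{dist}(z_2,-S)<2+\varepsilon$. The $c_0$-sum (resp. $\ell_\infty$-sum, $\ell_1$-sum) $[\bigoplus_\lambda E_\lambda]_F$ is the space of families $(x_\lambda)$ with $x_\lambda\in E_\lambda$ such that $(\|x_\lambda\|)_\lambda\in c_0(\Lambda)$ (resp. $\ell_\infty(\Lambda)$, $\ell_1(\Lambda)$), normed by the $F$-norm of $(\|x_\lambda\|)_\lambda$. *)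

theory Defs
  imports "HOL-Analysis.Analysis"
begin

text \<open>An abstract real normed space is given by a carrier X inside some type,
  an addition add, a scalar multiplication sc and a norm function N.
  Negation is sc (-1) and subtraction z - s is add z (sc (-1) s).\<close>

definition dual_sphere ::
  "'a set \<Rightarrow> ('a \<Rightarrow> 'a \<Rightarrow> 'a) \<Rightarrow> (real \<Rightarrow> 'a \<Rightarrow> 'a) \<Rightarrow> ('a \<Rightarrow> real) \<Rightarrow> ('a \<Rightarrow> real) set" where
  "dual_sphere X add sc N =
     {f. (\<forall>x\<in>X. \<forall>y\<in>X. f (add x y) = f x + f y)
       \<and> (\<forall>x\<in>X. \<forall>c. f (sc c x) = c * f x)
       \<and> bdd_above {\<bar>f x\<bar> | x. x \<in> X \<and> N x \<le> 1}
       \<and> Sup {\<bar>f x\<bar> | x. x \<in> X \<and> N x \<le> 1} = 1}"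

definition slice :: "'a set \<Rightarrow> ('a \<Rightarrow> real) \<Rightarrow> ('a \<Rightarrow> real) \<Rightarrow> real \<Rightarrow> 'a set" where
  "slice X N f \<alpha> = {z \<in> X. N z \<le> 1 \<and> f z > 1 - \<alpha>}"

definition set_dist ::
  "('a \<Rightarrow> 'a \<Rightarrow> 'a) \<Rightarrow> (real \<Rightarrow> 'a \<Rightarrow> 'a) \<Rightarrow> ('a \<Rightarrow> real) \<Rightarrow> 'a \<Rightarrow> 'a set \<Rightarrow> real" where
  "set_dist add sc N z S = Inf {N (add z (sc (-1) s)) | s. s \<in> S}"

text \<open>Property (**).\<close>
definition prop_ss ::
  "'a set \<Rightarrow> ('a \<Rightarrow> 'a \<Rightarrow> 'a) \<Rightarrow> (real \<Rightarrow> 'a \<Rightarrow> 'a) \<Rightarrow> ('a \<Rightarrow> real) \<Rightarrow> bool" where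
  "prop_ss X add sc N \<longleftrightarrow>
     (\<forall>z1\<in>X. \<forall>z2\<in>X. N z1 = 1 \<longrightarrow> N z2 = 1 \<longrightarrow>
       (\<forall>\<epsilon>>0. \<exists>f\<in>dual_sphere X add sc N.
          z1 \<in> slice X N f \<epsilon> \<and>
          set_dist add sc N z2 (slice X N f \<epsilon>)
            + set_dist add sc N z2 (sc (-1) ` slice X N f \<epsilon>) < 2 + \<epsilon>))"

text \<open>Property (**) for a closed linear subspace of a real Banach space, with the induced norm.\<close>
abbreviation prop_ss_sub :: "'b::real_normed_vector set \<Rightarrow> bool" where
  "prop_ss_sub X \<equiv> prop_ss X (+) scaleR norm"

datatype sum_kind = C0 | Linf | L1

definition sum_carrier :: "sum_kind \<Rightarrow> 'l set \<Rightarrow> ('l \<Rightarrow> 'b::real_normed_vector set) \<Rightarrow> ('l \<Rightarrow> 'b) set" where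
  "sum_carrier F \<Lambda> E =
     {x. (\<forall>l\<in>\<Lambda>. x l \<in> E l) \<and> (\<forall>l. l \<notin> \<Lambda> \<longrightarrow> x l = 0) \<and>
         (case F of
            C0 \<Rightarrow> (\<forall>\<epsilon>>0. finite {l \<in> \<Lambda>. norm (x l) \<ge> \<epsilon>})
          | Linf \<Rightarrow> bdd_above ((\<lambda>l. norm (x l)) ` \<Lambda>)
          | L1 \<Rightarrow> (\<lambda>l. norm (x l)) summable_on \<Lambda>)}"

definition sum_norm :: "sum_kind \<Rightarrow> 'l set \<Rightarrow> ('l \<Rightarrow> 'b::real_normed_vector) \<Rightarrow> real" where
  "sum_norm F \<Lambda> x =
     (case F of
        L1 \<Rightarrow> infsum (\<lambda>l. norm (x l)) \<Lambda>
      | _ \<Rightarrow> Sup (insert 0 ((\<lambda>l. norm (x l)) ` \<Lambda>)))"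

definition sum_add :: "('l \<Rightarrow> 'b::real_vector) \<Rightarrow> ('l \<Rightarrow> 'b) \<Rightarrow> ('l \<Rightarrow> 'b)" where
  "sum_add x y = (\<lambda>l. x l + y l)"

definition sum_scale :: "real \<Rightarrow> ('l \<Rightarrow> 'b::real_vector) \<Rightarrow> ('l \<Rightarrow> 'b)" where
  "sum_scale c x = (\<lambda>l. c *\<^sub>R x l)"

end

theory Submission
  imports Defs
begin

text \<open>If the sum has (**), apply it to vectors supported in a single coordinate l. The resulting
  functional restricts to E_l and, once normalised, witnesses (**) there: every point x of its
  slice can be traded for a point of the unit ball of E_l that is no farther from z_2 and -z_2,
  namely x_l for the sup-norms and x_l plus the mass of x off l in the direction of z_1 for the
  l_1-norm. Conversely, for c_0 and l_\<infinity> pick a coordinate l where z_1 is almost normed,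
  apply (**) in E_l and compose with the projection; the slice witnesses are z_2 and -z_2 with
  their l-th coordinate replaced. For l_1, pick finitely many coordinates carrying almost all the
  mass of z_1 and z_2, apply (**) in each of them and add up the functionals.\<close>

section \<open>Functionals and distances in an abstract normed space\<close>

lemma dual_sphere_add:
  "f \<in> dual_sphere X add sc N \<Longrightarrow> x \<in> X \<Longrightarrow> y \<in> X \<Longrightarrow> f (add x y) = f x + f y"
  by (simp add: dual_sphere_def)

lemma dual_sphere_scale:
  "f \<in> dual_sphere X add sc N \<Longrightarrow> x \<in> X \<Longrightarrow> f (sc c x) = c * f x"
  by (simp add: dual_sphere_def)

lemma dual_sphere_abs_le:
  assumes "f \<in> dual_sphere X add sc N" "x \<in> X" "N x \<le> 1"
  shows "\<bar>f x\<bar> \<le> 1"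
proof -
  have "bdd_above {\<bar>f x\<bar> | x. x \<in> X \<and> N x \<le> 1}" "Sup {\<bar>f x\<bar> | x. x \<in> X \<and> N x \<le> 1} = 1"
    using assms(1) by (auto simp: dual_sphere_def)
  then show ?thesis
    using assms(2,3) by (metis (mono_tags, lifting) cSup_upper mem_Collect_eq)
qed

lemma dual_sphere_approx:
  assumes "f \<in> dual_sphere X add sc N" "z \<in> X" "N z \<le> 1" "t < 1"
  obtains x where "x \<in> X" "N x \<le> 1" "t < \<bar>f x\<bar>"
proof -
  let ?V = "{\<bar>f x\<bar> | x. x \<in> X \<and> N x \<le> 1}"
  have "bdd_above ?V" "Sup ?V = 1"
    using assms(1) by (auto simp: dual_sphere_def)
  moreover have "?V \<noteq> {}"
    using assms(2,3) by blast
  ultimately have "\<exists>v\<in>?V. t < v"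
    using less_cSup_iff[of ?V t] assms(4) by simp
  then show ?thesis
    using that by blast
qed

lemma dual_sphereI:
  assumes "\<forall>x\<in>X. \<forall>y\<in>X. f (add x y) = f x + f y" "\<forall>x\<in>X. \<forall>c. f (sc c x) = c * f x"
    and le: "\<And>x. x \<in> X \<Longrightarrow> N x \<le> 1 \<Longrightarrow> \<bar>f x\<bar> \<le> 1"
    and approx: "\<And>t. t < 1 \<Longrightarrow> \<exists>x\<in>X. N x \<le> 1 \<and> t < \<bar>f x\<bar>"
  shows "f \<in> dual_sphere X add sc N"
proof -
  let ?V = "{\<bar>f x\<bar> | x. x \<in> X \<and> N x \<le> 1}"
  have bdd: "bdd_above ?V"
    using le by (auto intro: bdd_aboveI[where M = 1])
  have "Sup ?V = 1"
  proof (rule cSup_eq_non_empty)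
    show "?V \<noteq> {}"
      using approx[of 0] by auto
    show "v \<le> 1" if "v \<in> ?V" for v
      using that le by auto
    show "1 \<le> b" if "\<And>v. v \<in> ?V \<Longrightarrow> v \<le> b" for b
    proof (rule ccontr)
      assume "\<not> 1 \<le> b"
      then obtain x where "x \<in> X" "N x \<le> 1" "b < \<bar>f x\<bar>"
        using approx[of b] by auto
      then show False
        using that[of "\<bar>f x\<bar>"] by auto
    qed
  qed
  then show ?thesis
    using assms(1,2) bdd by (simp add: dual_sphere_def)
qed

lemma dual_sphere_normalise:
  assumes add: "\<forall>x\<in>X. \<forall>y\<in>X. f (add x y) = f x + f y"
    and scale: "\<forall>x\<in>X. \<forall>c. f (sc c x) = c * f x"
    and bound: "\<And>x. x \<in> X \<Longrightarrow> N x \<le> 1 \<Longrightarrow> \<bar>f x\<bar> \<le> C"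
    and z: "z \<in> X" "N z \<le> 1" "f z \<noteq> 0"
  obtains c where "0 < c" "c \<le> C" "(\<lambda>x. f x / c) \<in> dual_sphere X add sc N"
proof -
  let ?V = "{\<bar>f x\<bar> | x. x \<in> X \<and> N x \<le> 1}"
  define c where "c = Sup ?V"
  have ne: "?V \<noteq> {}" and bdd: "bdd_above ?V"
    using z bound by (auto intro: bdd_aboveI[where M = C])
  have le_c: "\<bar>f x\<bar> \<le> c" if "x \<in> X" "N x \<le> 1" for x
    unfolding c_def using bdd that by (auto intro: cSup_upper)
  have "c \<le> C"
    unfolding c_def using ne bound by (auto intro: cSup_least)
  have c: "0 < c"
    using le_c[OF z(1,2)] z(3) by linarith
  have "(\<lambda>x. f x / c) \<in> dual_sphere X add sc N"
  proof (rule dual_sphereI)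
    show "\<forall>x\<in>X. \<forall>y\<in>X. f (add x y) / c = f x / c + f y / c"
      using add by (simp add: add_divide_distrib)
    show "\<forall>x\<in>X. \<forall>a. f (sc a x) / c = a * (f x / c)"
      using scale by simp
    show "\<bar>f x / c\<bar> \<le> 1" if "x \<in> X" "N x \<le> 1" for x
      using le_c[OF that] c by simp
    show "\<exists>x\<in>X. N x \<le> 1 \<and> t < \<bar>f x / c\<bar>" if "t < 1" for t
    proof -
      have "t * c < c"
        using that c by simp
      then obtain x where "x \<in> X" "N x \<le> 1" "t * c < \<bar>f x\<bar>"
        unfolding c_def using less_cSup_iff[OF ne bdd] by auto
      then show ?thesis
        using c by (auto simp: pos_less_divide_eq)
    qed
  qed
  then show ?thesis
    using that[OF c \<open>c \<le> C\<close>] by simp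
qed

lemma dual_sphere_abs_le_norm:
  fixes g :: "'b::real_normed_vector \<Rightarrow> real"
  assumes g: "g \<in> dual_sphere X (+) scaleR norm" and X: "subspace X" and a: "a \<in> X"
  shows "\<bar>g a\<bar> \<le> norm a"
proof (cases "a = 0")
  case True
  then show ?thesis
    using dual_sphere_scale[OF g a, of 0] by simp
next
  case False
  have "sgn a \<in> X"
    using X a by (simp add: sgn_div_norm subspace_scale)
  then have "\<bar>g (sgn a)\<bar> \<le> 1"
    using dual_sphere_abs_le[OF g] by (simp add: norm_sgn)
  moreover have "g a = norm a * g (sgn a)"
    using dual_sphere_scale[OF g \<open>sgn a \<in> X\<close>, of "norm a"] False by (simp add: sgn_div_norm)
  ultimately show ?thesis
    by (simp add: abs_mult mult_left_le)
qed

lemma set_dist_le: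
  assumes "x \<in> S" "\<And>s. s \<in> S \<Longrightarrow> 0 \<le> N (add z (sc (-1) s))"
  shows "set_dist add sc N z S \<le> N (add z (sc (-1) x))"
proof -
  have "bdd_below {N (add z (sc (-1) s)) |s. s \<in> S}"
    by (rule bdd_belowI[where m = 0]) (use assms(2) in blast)
  then show ?thesis
    unfolding set_dist_def using assms(1) by (blast intro: cInf_lower)
qed

lemma set_dist_le_set_dist:
  assumes "S' \<noteq> {}" "\<And>s. s \<in> S \<Longrightarrow> 0 \<le> N (add z (sc (-1) s))"
    and "\<And>x. x \<in> S' \<Longrightarrow> \<exists>s\<in>S. N (add z (sc (-1) s)) \<le> N' (add' z' (sc' (-1) x))"
  shows "set_dist add sc N z S \<le> set_dist add' sc' N' z' S'"
  unfolding set_dist_def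
proof (rule cInf_greatest)
  show "{N' (add' z' (sc' (-1) x)) |x. x \<in> S'} \<noteq> {}"
    using assms(1) by blast
  fix b assume "b \<in> {N' (add' z' (sc' (-1) x)) |x. x \<in> S'}"
  then obtain x where x: "x \<in> S'" "b = N' (add' z' (sc' (-1) x))"
    by blast
  obtain s where s: "s \<in> S" "N (add z (sc (-1) s)) \<le> N' (add' z' (sc' (-1) x))"
    using assms(3)[OF x(1)] by (elim bexE)
  have "set_dist add sc N z S \<le> N (add z (sc (-1) s))"
    using s(1) assms(2) by (rule set_dist_le)
  then show "Inf {N (add z (sc (-1) s)) |s. s \<in> S} \<le> b"
    unfolding set_dist_def using s(2) x(2) by linarith
qed

lemma set_dist_less_witness:
  fixes v :: "'b::real_normed_vector"
  assumes "S \<noteq> {}" "set_dist (+) scaleR norm v S < r"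
  obtains s where "s \<in> S" "norm (v - s) < r"
proof -
  have "Inf {norm (v + (-1) *\<^sub>R s) |s. s \<in> S} < r"
    using assms(2) by (simp add: set_dist_def)
  moreover have "bdd_below {norm (v + (-1) *\<^sub>R s) |s. s \<in> S}"
    by (rule bdd_belowI[where m = 0]) auto
  ultimately have "\<exists>s\<in>S. norm (v + (-1) *\<^sub>R s) < r"
    using assms(1) cInf_less_iff[of "{norm (v + (-1) *\<^sub>R s) |s. s \<in> S}" r] by auto
  then show ?thesis
    using that by auto
qed

lemma set_dist_pair_witnesses:
  fixes v :: "'b::real_normed_vector"
  assumes "S \<noteq> {}"
    and "set_dist (+) scaleR norm v S + set_dist (+) scaleR norm v (scaleR (-1) ` S) < r"
  obtains s s' where "s \<in> S" "s' \<in> S" "norm (v - s) + norm (v + s') < r"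
proof -
  have "set_dist (+) scaleR norm v S < r - set_dist (+) scaleR norm v (scaleR (-1) ` S)"
    using assms(2) by linarith
  then obtain s where s: "s \<in> S" "norm (v - s) < r - set_dist (+) scaleR norm v (scaleR (-1) ` S)"
    using set_dist_less_witness[OF assms(1)] by blast
  moreover have "set_dist (+) scaleR norm v (scaleR (-1) ` S) < r - norm (v - s)"
    using s(2) by linarith
  then obtain s' where "s' \<in> scaleR (-1) ` S" "norm (v - s') < r - norm (v - s)"
    using set_dist_less_witness[of "scaleR (-1) ` S" v] assms(1) by blast
  then obtain s'' where "s'' \<in> S" "norm (v + s'') < r - norm (v - s)"
    by auto
  then show ?thesis
    using that[OF s(1) \<open>s'' \<in> S\<close>] by linarith
qed

lemma small_margin:
  fixes \<epsilon> :: real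
  assumes "0 < \<epsilon>"
  obtains \<delta> where "0 < \<delta>" "\<delta> \<le> 1 / 4" "4 * \<delta> \<le> \<epsilon>" "1 - \<epsilon> \<le> (1 - \<delta>) * (1 - \<delta>)"
proof -
  define \<delta> where "\<delta> = min \<epsilon> 1 / 4"
  have \<delta>: "0 < \<delta>" "\<delta> \<le> 1 / 4" "4 * \<delta> \<le> \<epsilon>"
    using assms by (auto simp: \<delta>_def)
  moreover have "1 - \<epsilon> \<le> (1 - \<delta>) * (1 - \<delta>)"
    using \<delta> zero_le_square[of \<delta>] by (simp only: left_diff_distrib right_diff_distrib)
  ultimately show ?thesis
    using that by blast
qed

lemma prop_ss_sub_witnesses:
  fixes w1 w2 :: "'b::real_normed_vector"
  assumes P: "prop_ss_sub X" and X: "subspace X"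
    and w: "w1 \<in> X" "w2 \<in> X" "w1 \<noteq> 0 \<or> w2 \<noteq> 0" and \<delta>: "0 < \<delta>"
  obtains g v s s' where "g \<in> dual_sphere X (+) scaleR norm"
    "s \<in> slice X norm g \<delta>" "s' \<in> slice X norm g \<delta>" "(1 - \<delta>) * norm w1 \<le> g w1"
    "w2 = norm w2 *\<^sub>R v" "norm (v - s) + norm (v + s') < 2 + \<delta>"
proof -
  have sgn_in: "sgn w \<in> X" if "w \<in> X" for w
    using X that by (simp add: sgn_div_norm subspace_scale)
  define u where "u = (if w1 = 0 then sgn w2 else sgn w1)"
  define v where "v = (if w2 = 0 then u else sgn w2)"
  have u: "u \<in> X" "norm u = 1" "w1 = norm w1 *\<^sub>R u"
    using w sgn_in by (auto simp: u_def norm_sgn sgn_div_norm)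
  have v: "v \<in> X" "norm v = 1" "w2 = norm w2 *\<^sub>R v"
    using w u sgn_in by (auto simp: v_def norm_sgn sgn_div_norm)
  obtain g where g: "g \<in> dual_sphere X (+) scaleR norm" "u \<in> slice X norm g \<delta>"
    and d: "set_dist (+) scaleR norm v (slice X norm g \<delta>)
            + set_dist (+) scaleR norm v (scaleR (-1) ` slice X norm g \<delta>) < 2 + \<delta>"
    using P u(1,2) v(1,2) \<delta> unfolding prop_ss_def by blast
  obtain s s' where s: "s \<in> slice X norm g \<delta>" "s' \<in> slice X norm g \<delta>"
    and ss: "norm (v - s) + norm (v + s') < 2 + \<delta>"
    using set_dist_pair_witnesses[OF _ d] g(2) by blast
  have "g w1 = norm w1 * g u"
    using g(1) u(1) by (subst u(3)) (simp add: dual_sphere_def)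
  moreover have "1 - \<delta> < g u"
    using g(2) by (simp add: slice_def)
  ultimately have "(1 - \<delta>) * norm w1 \<le> g w1"
    by (simp add: mult.commute mult_left_mono)
  then show ?thesis
    using that g(1) s ss v(3) by blast
qed

lemma norm_scaled_pair_le:
  fixes v s s' :: "'b::real_normed_vector"
  assumes t: "0 \<le> t" "t \<le> 1" and s: "norm s \<le> 1" "norm s' \<le> 1"
    and d: "norm (v - s) + norm (v + s') \<le> 2 + \<delta>" and \<delta>: "0 \<le> \<delta>"
  shows "norm (t *\<^sub>R v - s) + norm (t *\<^sub>R v + s') \<le> 2 + \<delta>"
proof -
  have "t *\<^sub>R v - s = t *\<^sub>R (v - s) - (1 - t) *\<^sub>R s"
    by (simp add: algebra_simps)
  then have 1: "norm (t *\<^sub>R v - s) \<le> t * norm (v - s) + (1 - t) * norm s"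
    using t by (metis abs_of_nonneg diff_ge_0_iff_ge norm_scaleR norm_triangle_ineq4)
  have "t *\<^sub>R v + s' = t *\<^sub>R (v + s') + (1 - t) *\<^sub>R s'"
    by (simp add: algebra_simps)
  then have 2: "norm (t *\<^sub>R v + s') \<le> t * norm (v + s') + (1 - t) * norm s'"
    using t by (metis abs_of_nonneg diff_ge_0_iff_ge norm_scaleR norm_triangle_ineq)
  have "t * (norm (v - s) + norm (v + s')) \<le> t * (2 + \<delta>)"
    using t d by (simp add: mult_left_mono)
  moreover have "(1 - t) * norm s \<le> 1 - t" "(1 - t) * norm s' \<le> 1 - t"
    using t s by (simp_all add: mult_left_le)
  moreover have "t * (2 + \<delta>) + 2 * (1 - t) \<le> 2 + \<delta>"
    using t \<delta> by (simp add: algebra_simps mult_left_le)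
  ultimately show ?thesis
    using 1 2 by (simp add: algebra_simps)
qed

section \<open>Coordinates of c_0, l_\<infinity> and l_1 sums\<close>

lemma sum_carrier_component:
  "x \<in> sum_carrier F \<Lambda> E \<Longrightarrow> l \<in> \<Lambda> \<Longrightarrow> x l \<in> E l"
  by (simp add: sum_carrier_def)

lemma c0_finite_level:
  "x \<in> sum_carrier C0 \<Lambda> E \<Longrightarrow> 0 < e \<Longrightarrow> finite {k \<in> \<Lambda>. e \<le> norm (x k)}"
  by (simp add: sum_carrier_def)

lemma sum_carrier_l1_summable:
  "x \<in> sum_carrier L1 \<Lambda> E \<Longrightarrow> (\<lambda>k. norm (x k)) summable_on \<Lambda>"
  by (simp add: sum_carrier_def)

lemma sum_carrier_zero:
  assumes "\<forall>k\<in>\<Lambda>. subspace (E k)"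
  shows "(\<lambda>_. 0) \<in> sum_carrier F \<Lambda> E"
  using assms by (cases F) (auto simp: sum_carrier_def subspace_0)

lemma bdd_above_norm_update:
  "bdd_above ((\<lambda>k. norm (x k)) ` \<Lambda>) \<Longrightarrow> bdd_above ((\<lambda>k. norm ((x(l := a)) k)) ` \<Lambda>)"
  by (rule bdd_above_mono[of "insert (norm a) ((\<lambda>k. norm (x k)) ` \<Lambda>)"]) auto

lemma summable_norm_update:
  assumes "(\<lambda>k. norm (x k)) summable_on \<Lambda>"
  shows "(\<lambda>k. norm ((x(l := a)) k)) summable_on \<Lambda>"
proof -
  have "(\<lambda>k. norm (x k)) summable_on (\<Lambda> - {l})"
    using assms by (rule summable_on_subset_banach) auto
  then have "(\<lambda>k. norm ((x(l := a)) k)) summable_on (\<Lambda> - {l})"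
    by (rule summable_on_cong[THEN iffD1, rotated]) auto
  then have "(\<lambda>k. norm ((x(l := a)) k)) summable_on insert l (\<Lambda> - {l})"
    by (rule summable_on_insert_iff[THEN iffD2])
  then show ?thesis
    by (rule summable_on_subset_banach) auto
qed

lemma sum_carrier_update:
  assumes x: "x \<in> sum_carrier F \<Lambda> E" and l: "l \<in> \<Lambda>" and a: "a \<in> E l"
  shows "x(l := a) \<in> sum_carrier F \<Lambda> E"
proof (cases F)
  case C0
  have "finite {k \<in> \<Lambda>. e \<le> norm ((x(l := a)) k)}" if "e > 0" for e
  proof (rule finite_subset)
    show "finite (insert l {k \<in> \<Lambda>. e \<le> norm (x k)})"
      using c0_finite_level x C0 that by simp
  qed auto
  then show ?thesis
    using x l a C0 unfolding sum_carrier_def by auto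
next
  case Linf
  then show ?thesis
    using x l a bdd_above_norm_update unfolding sum_carrier_def by auto
next
  case L1
  then show ?thesis
    using x l a summable_norm_update unfolding sum_carrier_def by auto
qed

lemma sum_carrier_single:
  assumes "\<forall>k\<in>\<Lambda>. subspace (E k)" "l \<in> \<Lambda>" "a \<in> E l"
  shows "(\<lambda>_. 0)(l := a) \<in> sum_carrier F \<Lambda> E"
  using sum_carrier_update[OF sum_carrier_zero[OF assms(1)] assms(2,3)] .

lemma sum_carrier_uminus:
  assumes "\<forall>k\<in>\<Lambda>. subspace (E k)" "x \<in> sum_carrier F \<Lambda> E"
  shows "(\<lambda>k. - x k) \<in> sum_carrier F \<Lambda> E"
  using assms by (cases F) (auto simp: sum_carrier_def subspace_neg)

lemma sum_carrier_add:
  assumes sub: "\<forall>k\<in>\<Lambda>. subspace (E k)"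
    and x: "x \<in> sum_carrier F \<Lambda> E" and y: "y \<in> sum_carrier F \<Lambda> E"
  shows "(\<lambda>k. x k + y k) \<in> sum_carrier F \<Lambda> E"
proof -
  have comps: "\<forall>k\<in>\<Lambda>. x k + y k \<in> E k" "\<forall>k. k \<notin> \<Lambda> \<longrightarrow> x k + y k = 0"
    using sub x y by (auto simp: sum_carrier_def subspace_add)
  show ?thesis
  proof (cases F)
    case C0
    have "finite {k \<in> \<Lambda>. e \<le> norm (x k + y k)}" if e: "e > 0" for e
    proof (rule finite_subset)
      show "finite ({k \<in> \<Lambda>. e / 2 \<le> norm (x k)} \<union> {k \<in> \<Lambda>. e / 2 \<le> norm (y k)})"
        using c0_finite_level[of _ \<Lambda> E "e / 2"] x y C0 e by simp
      show "{k \<in> \<Lambda>. e \<le> norm (x k + y k)}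
          \<subseteq> {k \<in> \<Lambda>. e / 2 \<le> norm (x k)} \<union> {k \<in> \<Lambda>. e / 2 \<le> norm (y k)}"
      proof
        fix k assume "k \<in> {k \<in> \<Lambda>. e \<le> norm (x k + y k)}"
        moreover have "norm (x k + y k) \<le> norm (x k) + norm (y k)"
          by (rule norm_triangle_ineq)
        ultimately show "k \<in> {k \<in> \<Lambda>. e / 2 \<le> norm (x k)} \<union> {k \<in> \<Lambda>. e / 2 \<le> norm (y k)}"
          by auto
      qed
    qed
    then show ?thesis
      using comps C0 unfolding sum_carrier_def by auto
  next
    case Linf
    obtain Mx My where "\<forall>k\<in>\<Lambda>. norm (x k) \<le> Mx" "\<forall>k\<in>\<Lambda>. norm (y k) \<le> My"
      using x y Linf by (auto simp: sum_carrier_def bdd_above_def)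
    then have "\<forall>k\<in>\<Lambda>. norm (x k + y k) \<le> Mx + My"
      by (meson add_mono norm_triangle_ineq order_trans)
    then have "bdd_above ((\<lambda>k. norm (x k + y k)) ` \<Lambda>)"
      by (auto intro: bdd_aboveI[where M = "Mx + My"])
    then show ?thesis
      using comps Linf unfolding sum_carrier_def by auto
  next
    case L1
    have "(\<lambda>k. norm (x k) + norm (y k)) summable_on \<Lambda>"
      using x y L1 by (intro summable_on_add) (auto simp: sum_carrier_def)
    then have "(\<lambda>k. norm (x k + y k)) summable_on \<Lambda>"
      by (rule summable_on_comparison_test) (auto intro: norm_triangle_ineq)
    then show ?thesis
      using comps L1 unfolding sum_carrier_def by auto
  qed
qed

lemma sum_carrier_diff:
  assumes "\<forall>k\<in>\<Lambda>. subspace (E k)" "x \<in> sum_carrier F \<Lambda> E" "y \<in> sum_carrier F \<Lambda> E"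
  shows "(\<lambda>k. x k - y k) \<in> sum_carrier F \<Lambda> E"
  using sum_carrier_add[OF assms(1,2) sum_carrier_uminus[OF assms(1,3)]] by simp

lemma sum_norm_cong:
  assumes "\<And>k. norm (w k) = norm (x k)"
  shows "sum_norm F \<Lambda> w = sum_norm F \<Lambda> x"
  by (cases F) (simp_all add: sum_norm_def assms)

lemma sum_norm_sup:
  "F \<noteq> L1 \<Longrightarrow> sum_norm F \<Lambda> x = Sup (insert 0 ((\<lambda>l. norm (x l)) ` \<Lambda>))"
  by (cases F) (auto simp: sum_norm_def)

lemma sum_carrier_bdd_above:
  assumes x: "x \<in> sum_carrier F \<Lambda> E" and F: "F \<noteq> L1"
  shows "bdd_above ((\<lambda>l. norm (x l)) ` \<Lambda>)"
proof (cases F)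
  case C0
  then have "finite {l \<in> \<Lambda>. 1 \<le> norm (x l)}"
    using c0_finite_level[of x \<Lambda> E 1] x by simp
  then have "bdd_above ({..1} \<union> (\<lambda>l. norm (x l)) ` {l \<in> \<Lambda>. 1 \<le> norm (x l)})"
    by simp
  then show ?thesis
    by (rule bdd_above_mono) auto
next
  case Linf
  then show ?thesis
    using x by (simp add: sum_carrier_def)
qed (use F in simp)

lemma sup_norm_le_iff:
  assumes "bdd_above ((\<lambda>l. norm (x l)) ` \<Lambda>)" "F \<noteq> L1"
  shows "sum_norm F \<Lambda> x \<le> r \<longleftrightarrow> 0 \<le> r \<and> (\<forall>l\<in>\<Lambda>. norm (x l) \<le> r)"
  unfolding sum_norm_sup[OF assms(2)] using assms(1) by (subst cSup_le_iff) auto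

lemma l1_norm_split:
  assumes "(\<lambda>k. norm (x k)) summable_on \<Lambda>" "finite A" "A \<subseteq> \<Lambda>"
  shows "sum_norm L1 \<Lambda> x = (\<Sum>k\<in>A. norm (x k)) + infsum (\<lambda>k. norm (x k)) (\<Lambda> - A)"
proof -
  have "(\<lambda>k. norm (x k)) summable_on (\<Lambda> - A)"
    using assms(1) by (rule summable_on_subset_banach) auto
  then have "infsum (\<lambda>k. norm (x k)) (A \<union> (\<Lambda> - A))
      = infsum (\<lambda>k. norm (x k)) A + infsum (\<lambda>k. norm (x k)) (\<Lambda> - A)"
    using assms(2) by (intro infsum_Un_disjoint) auto
  moreover have "A \<union> (\<Lambda> - A) = \<Lambda>"
    using assms(3) by auto
  ultimately show ?thesis
    using assms(2) by (simp add: sum_norm_def)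
qed

lemma norm_le_sum_norm:
  assumes x: "x \<in> sum_carrier F \<Lambda> E" and l: "l \<in> \<Lambda>"
  shows "norm (x l) \<le> sum_norm F \<Lambda> x"
proof (cases "F = L1")
  case True
  then have s: "(\<lambda>k. norm (x k)) summable_on \<Lambda>"
    using x sum_carrier_l1_summable by blast
  show ?thesis
    using l1_norm_split[OF s, where A = "{l}"] True l by (simp add: infsum_nonneg)
next
  case False
  then show ?thesis
    using sup_norm_le_iff[OF sum_carrier_bdd_above[OF x False] False] l by blast
qed

lemma sum_norm_nonneg:
  assumes "x \<in> sum_carrier F \<Lambda> E"
  shows "0 \<le> sum_norm F \<Lambda> x"
proof (cases "F = L1")
  case True
  then show ?thesis
    by (simp add: sum_norm_def infsum_nonneg)
next
  case False
  then show ?thesis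
    using sup_norm_le_iff[OF sum_carrier_bdd_above[OF assms False] False] by blast
qed

lemma sum_norm_update:
  assumes x: "x \<in> sum_carrier F \<Lambda> E" and l: "l \<in> \<Lambda>"
  shows "sum_norm F \<Lambda> (x(l := a)) = (if F = L1 then norm a + sum_norm F \<Lambda> (x(l := 0))
                                     else max (norm a) (sum_norm F \<Lambda> (x(l := 0))))"
proof (cases "F = L1")
  case True
  have s: "(\<lambda>k. norm (x k)) summable_on \<Lambda>"
    using x True by (simp add: sum_carrier_def)
  have "sum_norm L1 \<Lambda> (x(l := b)) = norm b + infsum (\<lambda>k. norm (x k)) (\<Lambda> - {l})" for b
  proof -
    have "infsum (\<lambda>k. norm ((x(l := b)) k)) (\<Lambda> - {l}) = infsum (\<lambda>k. norm (x k)) (\<Lambda> - {l})"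
      by (rule infsum_cong) auto
    then show ?thesis
      using l1_norm_split[OF summable_norm_update[OF s, of l b], where A = "{l}"] l
      by (simp add: fun_upd_def)
  qed
  then show ?thesis
    using True by simp
next
  case False
  have bdd: "bdd_above ((\<lambda>k. norm ((x(l := b)) k)) ` \<Lambda>)" for b
    using bdd_above_norm_update[OF sum_carrier_bdd_above[OF x False]] .
  have "sum_norm F \<Lambda> (x(l := a)) \<le> r \<longleftrightarrow> max (norm a) (sum_norm F \<Lambda> (x(l := 0))) \<le> r" for r
    unfolding sup_norm_le_iff[OF bdd False] max.bounded_iff using l by auto
  then show ?thesis
    using False by (metis order.antisym order.refl)
qed

lemma sum_norm_single:
  fixes E :: "'l \<Rightarrow> 'b::real_normed_vector set" and a :: 'b
  assumes "\<forall>k\<in>\<Lambda>. subspace (E k)" "l \<in> \<Lambda>"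
  shows "sum_norm F \<Lambda> ((\<lambda>_. 0)(l := a)) = norm a"
proof -
  have "sum_norm F \<Lambda> ((\<lambda>_. 0)(l := 0)) = 0"
    by (cases F) (auto simp: sum_norm_def image_constant_conv)
  then show ?thesis
    using sum_norm_update[OF sum_carrier_zero[OF assms(1)] assms(2), of F a]
    by (cases "F = L1") auto
qed

lemma sum_set_dist_le:
  assumes sub: "\<forall>k\<in>\<Lambda>. subspace (E k)" and z: "z \<in> sum_carrier F \<Lambda> E"
    and S: "S \<subseteq> sum_carrier F \<Lambda> E" and x: "x \<in> S"
  shows "set_dist sum_add sum_scale (sum_norm F \<Lambda>) z S \<le> sum_norm F \<Lambda> (\<lambda>k. z k - x k)"
    and "set_dist sum_add sum_scale (sum_norm F \<Lambda>) z (sum_scale (-1) ` S) \<le> sum_norm F \<Lambda> (\<lambda>k. z k + x k)"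
proof -
  have diff: "sum_add z (sum_scale (-1) s) = (\<lambda>k. z k - s k)" for s
    by (simp add: sum_add_def sum_scale_def)
  have sum: "sum_add z (sum_scale (-1) (sum_scale (-1) s)) = (\<lambda>k. z k + s k)" for s
    by (simp add: sum_add_def sum_scale_def)
  have "set_dist sum_add sum_scale (sum_norm F \<Lambda>) z S \<le> sum_norm F \<Lambda> (sum_add z (sum_scale (-1) x))"
  proof (rule set_dist_le[OF x])
    fix s assume "s \<in> S"
    then have "s \<in> sum_carrier F \<Lambda> E"
      using S by blast
    then show "0 \<le> sum_norm F \<Lambda> (sum_add z (sum_scale (-1) s))"
      unfolding diff by (rule sum_norm_nonneg[OF sum_carrier_diff[OF sub z]])
  qed
  then show "set_dist sum_add sum_scale (sum_norm F \<Lambda>) z S \<le> sum_norm F \<Lambda> (\<lambda>k. z k - x k)"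
    by (simp only: diff)
  have "set_dist sum_add sum_scale (sum_norm F \<Lambda>) z (sum_scale (-1) ` S)
      \<le> sum_norm F \<Lambda> (sum_add z (sum_scale (-1) (sum_scale (-1) x)))"
  proof (rule set_dist_le)
    show "sum_scale (-1) x \<in> sum_scale (-1) ` S"
      using x by (rule imageI)
    fix s assume "s \<in> sum_scale (-1) ` S"
    then obtain s0 where s0: "s0 \<in> sum_carrier F \<Lambda> E" "s = sum_scale (-1) s0"
      using S by blast
    show "0 \<le> sum_norm F \<Lambda> (sum_add z (sum_scale (-1) s))"
      unfolding s0(2) sum by (rule sum_norm_nonneg[OF sum_carrier_add[OF sub z s0(1)]])
  qed
  then show "set_dist sum_add sum_scale (sum_norm F \<Lambda>) z (sum_scale (-1) ` S) \<le> sum_norm F \<Lambda> (\<lambda>k. z k + x k)"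
    by (simp only: sum)
qed

lemma set_dist_le_sum_set_dist:
  fixes v :: "'b::real_normed_vector"
  assumes "T \<noteq> {}"
    and retract: "\<And>x. x \<in> T \<Longrightarrow> \<exists>s\<in>S. norm (v - s) \<le> sum_norm F \<Lambda> (\<lambda>k. z k - x k)
                                  \<and> norm (v + s) \<le> sum_norm F \<Lambda> (\<lambda>k. z k + x k)"
  shows "set_dist (+) scaleR norm v S \<le> set_dist sum_add sum_scale (sum_norm F \<Lambda>) z T"
    and "set_dist (+) scaleR norm v (scaleR (-1) ` S)
           \<le> set_dist sum_add sum_scale (sum_norm F \<Lambda>) z (sum_scale (-1) ` T)"
proof -
  show "set_dist (+) scaleR norm v S \<le> set_dist sum_add sum_scale (sum_norm F \<Lambda>) z T"
    using assms by (intro set_dist_le_set_dist) (auto simp: sum_add_def sum_scale_def)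
  show "set_dist (+) scaleR norm v (scaleR (-1) ` S)
      \<le> set_dist sum_add sum_scale (sum_norm F \<Lambda>) z (sum_scale (-1) ` T)"
  proof (rule set_dist_le_set_dist)
    fix y assume "y \<in> sum_scale (-1) ` T"
    then obtain x where "x \<in> T" "y = sum_scale (-1) x"
      by blast
    then obtain s where "s \<in> S" "norm (v + s) \<le> sum_norm F \<Lambda> (\<lambda>k. z k + x k)"
      using retract by blast
    moreover have "sum_add z (sum_scale (-1) y) = (\<lambda>k. z k + x k)"
      using \<open>y = sum_scale (-1) x\<close> by (auto simp: sum_add_def sum_scale_def)
    ultimately show "\<exists>s\<in>scaleR (-1) ` S. norm (v + (-1) *\<^sub>R s) \<le> sum_norm F \<Lambda> (sum_add z (sum_scale (-1) y))"
      by force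
  qed (use assms(1) in auto)
qed

lemma dual_sphere_restrict_component:
  assumes sub: "\<forall>k\<in>\<Lambda>. subspace (E k)" and l: "l \<in> \<Lambda>"
    and f: "f \<in> dual_sphere (sum_carrier F \<Lambda> E) sum_add sum_scale (sum_norm F \<Lambda>)"
  shows "\<forall>a\<in>E l. \<forall>b\<in>E l. f ((\<lambda>_. 0)(l := a + b)) = f ((\<lambda>_. 0)(l := a)) + f ((\<lambda>_. 0)(l := b))"
    and "\<forall>a\<in>E l. \<forall>c. f ((\<lambda>_. 0)(l := c *\<^sub>R a)) = c * f ((\<lambda>_. 0)(l := a))"
    and "\<And>a. a \<in> E l \<Longrightarrow> norm a \<le> 1 \<Longrightarrow> \<bar>f ((\<lambda>_. 0)(l := a))\<bar> \<le> 1"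
proof -
  have single: "(\<lambda>_. 0)(l := a) \<in> sum_carrier F \<Lambda> E" if "a \<in> E l" for a
    using sum_carrier_single[OF sub l that] .
  have "(\<lambda>_. 0)(l := a + b) = sum_add ((\<lambda>_. 0)(l := a)) ((\<lambda>_. 0)(l := b))" for a b :: 'b
    by (auto simp: sum_add_def)
  then show "\<forall>a\<in>E l. \<forall>b\<in>E l. f ((\<lambda>_. 0)(l := a + b)) = f ((\<lambda>_. 0)(l := a)) + f ((\<lambda>_. 0)(l := b))"
    using dual_sphere_add[OF f single single] by simp
  have "(\<lambda>_. 0)(l := c *\<^sub>R a) = sum_scale c ((\<lambda>_. 0)(l := a))" for c and a :: 'b
    by (auto simp: sum_scale_def)
  then show "\<forall>a\<in>E l. \<forall>c. f ((\<lambda>_. 0)(l := c *\<^sub>R a)) = c * f ((\<lambda>_. 0)(l := a))"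
    using dual_sphere_scale[OF f single] by simp
  show "\<bar>f ((\<lambda>_. 0)(l := a))\<bar> \<le> 1" if "a \<in> E l" "norm a \<le> 1" for a
    using dual_sphere_abs_le[OF f single[OF that(1)]] sum_norm_single[OF sub l] that(2) by simp
qed

lemma dual_sphere_update:
  assumes sub: "\<forall>k\<in>\<Lambda>. subspace (E k)" and l: "l \<in> \<Lambda>"
    and f: "f \<in> dual_sphere (sum_carrier F \<Lambda> E) sum_add sum_scale (sum_norm F \<Lambda>)"
    and x: "x \<in> sum_carrier F \<Lambda> E" and a: "a \<in> E l"
  shows "f (x(l := a)) = f ((\<lambda>_. 0)(l := a)) + f (x(l := 0))"
proof -
  have "x(l := a) = sum_add ((\<lambda>_. 0)(l := a)) (x(l := 0))"
    by (auto simp: sum_add_def)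
  moreover have "x(l := 0) \<in> sum_carrier F \<Lambda> E"
    using sum_carrier_update[OF x l] sub l subspace_0 by blast
  ultimately show ?thesis
    using dual_sphere_add[OF f sum_carrier_single[OF sub l a]] by simp
qed

lemma dual_sphere_component:
  assumes sub: "\<forall>k\<in>\<Lambda>. subspace (E k)" and l: "l \<in> \<Lambda>"
    and g: "g \<in> dual_sphere (E l) (+) scaleR norm"
  shows "(\<lambda>x. g (x l)) \<in> dual_sphere (sum_carrier F \<Lambda> E) sum_add sum_scale (sum_norm F \<Lambda>)"
proof (rule dual_sphereI)
  show "\<forall>x\<in>sum_carrier F \<Lambda> E. \<forall>y\<in>sum_carrier F \<Lambda> E. g (sum_add x y l) = g (x l) + g (y l)"
    using dual_sphere_add[OF g] sum_carrier_component[of _ F \<Lambda> E l] l by (simp add: sum_add_def)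
  show "\<forall>x\<in>sum_carrier F \<Lambda> E. \<forall>c. g (sum_scale c x l) = c * g (x l)"
    using dual_sphere_scale[OF g] sum_carrier_component[of _ F \<Lambda> E l] l by (simp add: sum_scale_def)
  show "\<bar>g (x l)\<bar> \<le> 1" if "x \<in> sum_carrier F \<Lambda> E" "sum_norm F \<Lambda> x \<le> 1" for x
    using dual_sphere_abs_le[OF g] sum_carrier_component[OF that(1) l]
      norm_le_sum_norm[OF that(1) l] that(2) by simp
  show "\<exists>x\<in>sum_carrier F \<Lambda> E. sum_norm F \<Lambda> x \<le> 1 \<and> t < \<bar>g (x l)\<bar>" if t: "t < 1" for t
  proof -
    obtain a where "a \<in> E l" "norm a \<le> 1" "t < \<bar>g a\<bar>"
      using dual_sphere_approx[OF g _ _ t, of 0] sub l subspace_0 by auto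
    then show ?thesis
      using sum_carrier_single[OF sub l] sum_norm_single[OF sub l, of F a]
      by (intro bexI[of _ "(\<lambda>_. 0)(l := a)"]) auto
  qed
qed

section \<open>Property (**) passes to the summands\<close>

lemma sum_norm_split_at:
  assumes sub: "\<forall>k\<in>\<Lambda>. subspace (E k)" and l: "l \<in> \<Lambda>"
    and x: "x \<in> sum_carrier F \<Lambda> E" "sum_norm F \<Lambda> x \<le> 1" and u: "norm u = 1"
  obtains b where "0 \<le> b" "norm (x l) + b \<le> 1" "sum_norm F \<Lambda> (x(l := (1 - b) *\<^sub>R u)) \<le> 1"
    "\<And>v w. v \<in> sum_carrier F \<Lambda> E \<Longrightarrow> (\<And>k. norm (v k) = norm (x k))
       \<Longrightarrow> norm w + b \<le> sum_norm F \<Lambda> (v(l := w))"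
proof -
  let ?N = "sum_norm F \<Lambda>"
  define b where "b = (if F = L1 then ?N (x(l := 0)) else 0)"
  have "x(l := 0) \<in> sum_carrier F \<Lambda> E"
    using sum_carrier_update[OF x(1) l] sub l subspace_0 by blast
  then have y: "0 \<le> ?N (x(l := 0))"
    by (rule sum_norm_nonneg)
  have "?N x = (if F = L1 then norm (x l) + ?N (x(l := 0)) else max (norm (x l)) (?N (x(l := 0))))"
    using sum_norm_update[OF x(1) l, of "x l"] by simp
  then have xl: "norm (x l) + b \<le> 1" "?N (x(l := 0)) \<le> 1"
    using x(2) y norm_ge_zero[of "x l"] unfolding b_def by (smt (verit))+
  have "0 \<le> b"
    using y by (auto simp: b_def)
  moreover have "?N (x(l := (1 - b) *\<^sub>R u)) \<le> 1"
    using sum_norm_update[OF x(1) l, of "(1 - b) *\<^sub>R u"] xl u \<open>0 \<le> b\<close>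
    by (auto simp: b_def)
  moreover have "norm w + b \<le> ?N (v(l := w))"
    if "v \<in> sum_carrier F \<Lambda> E" "\<And>k. norm (v k) = norm (x k)" for v w
  proof -
    have "?N (v(l := 0)) = ?N (x(l := 0))"
      using that(2) by (intro sum_norm_cong) simp
    then show ?thesis
      using sum_norm_update[OF that(1) l, of w] y by (auto simp: b_def)
  qed
  ultimately show ?thesis
    using that xl(1) by blast
qed

lemma ball_retract_component:
  assumes sub: "\<forall>k\<in>\<Lambda>. subspace (E k)" and l: "l \<in> \<Lambda>"
    and f: "f \<in> dual_sphere (sum_carrier F \<Lambda> E) sum_add sum_scale (sum_norm F \<Lambda>)"
    and z1: "z1 \<in> E l" "norm z1 = 1" and z2: "z2 \<in> E l"
    and x: "x \<in> sum_carrier F \<Lambda> E" "sum_norm F \<Lambda> x \<le> 1"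
  obtains s where "s \<in> E l" "norm s \<le> 1"
    "f x - 1 + f ((\<lambda>_. 0)(l := z1)) \<le> f ((\<lambda>_. 0)(l := s))"
    "norm (z2 - s) \<le> sum_norm F \<Lambda> (\<lambda>k. ((\<lambda>_. 0)(l := z2)) k - x k)"
    "norm (z2 + s) \<le> sum_norm F \<Lambda> (\<lambda>k. ((\<lambda>_. 0)(l := z2)) k + x k)"
proof -
  let ?g = "\<lambda>a. f ((\<lambda>_. 0)(l := a))"
  note g = dual_sphere_restrict_component[OF sub l f]
  obtain b where b: "0 \<le> b" "norm (x l) + b \<le> 1" "sum_norm F \<Lambda> (x(l := (1 - b) *\<^sub>R z1)) \<le> 1"
    and far: "\<And>v w. v \<in> sum_carrier F \<Lambda> E \<Longrightarrow> (\<And>k. norm (v k) = norm (x k))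
       \<Longrightarrow> norm w + b \<le> sum_norm F \<Lambda> (v(l := w))"
    using sum_norm_split_at[OF sub l x z1(2)] by blast
  \<comment> \<open>the mass b of x off l is moved onto the direction z1\<close>
  define s where "s = x l + b *\<^sub>R z1"
  have subl: "subspace (E l)" and xl: "x l \<in> E l"
    using sub l sum_carrier_component[OF x(1) l] by auto
  have z1b: "(1 - b) *\<^sub>R z1 \<in> E l" and bz1: "b *\<^sub>R z1 \<in> E l"
    using subl z1(1) by (auto intro: subspace_scale)
  have "s \<in> E l"
    unfolding s_def using subl xl bz1 by (rule subspace_add)
  moreover have "norm s \<le> 1"
    using norm_triangle_ineq[of "x l" "b *\<^sub>R z1"] b z1(2) by (simp add: s_def)
  moreover have "f x - 1 + ?g z1 \<le> ?g s"
  proof -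
    have "\<bar>f (x(l := (1 - b) *\<^sub>R z1))\<bar> \<le> 1"
      using dual_sphere_abs_le[OF f sum_carrier_update[OF x(1) l z1b]] b(3) by blast
    moreover have "f (x(l := (1 - b) *\<^sub>R z1)) = (1 - b) * ?g z1 + f (x(l := 0))"
      using dual_sphere_update[OF sub l f x(1) z1b] g(2) z1(1) by simp
    moreover have "f x = ?g (x l) + f (x(l := 0))"
      using dual_sphere_update[OF sub l f x(1) xl] by simp
    moreover have "?g s = ?g (x l) + b * ?g z1"
      using g(1,2) xl bz1 z1(1) by (simp add: s_def)
    ultimately show ?thesis
      by (simp add: algebra_simps)
  qed
  moreover have "norm (z2 - s) \<le> sum_norm F \<Lambda> (\<lambda>k. ((\<lambda>_. 0)(l := z2)) k - x k)"
  proof -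
    have "(\<lambda>k. ((\<lambda>_. 0)(l := z2)) k - x k) = (\<lambda>k. - x k)(l := z2 - x l)"
      by auto
    moreover have "norm (z2 - s) \<le> norm (z2 - x l) + b"
      using norm_triangle_ineq4[of "z2 - x l" "b *\<^sub>R z1"] b(1) z1(2) by (simp add: s_def algebra_simps)
    ultimately show ?thesis
      using far[OF sum_carrier_uminus[OF sub x(1)], of "z2 - x l"] by simp
  qed
  moreover have "norm (z2 + s) \<le> sum_norm F \<Lambda> (\<lambda>k. ((\<lambda>_. 0)(l := z2)) k + x k)"
  proof -
    have "(\<lambda>k. ((\<lambda>_. 0)(l := z2)) k + x k) = x(l := z2 + x l)"
      by auto
    moreover have "norm (z2 + s) \<le> norm (z2 + x l) + b"
      using norm_triangle_ineq[of "z2 + x l" "b *\<^sub>R z1"] b(1) z1(2) by (simp add: s_def algebra_simps)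
    ultimately show ?thesis
      using far[OF x(1), of "z2 + x l"] by simp
  qed
  ultimately show ?thesis
    using that by blast
qed

lemma prop_ss_summand:
  assumes sub: "\<forall>k\<in>\<Lambda>. subspace (E k)" and l: "l \<in> \<Lambda>"
    and P: "prop_ss (sum_carrier F \<Lambda> E) sum_add sum_scale (sum_norm F \<Lambda>)"
  shows "prop_ss_sub (E l)"
  unfolding prop_ss_def
proof (intro ballI impI allI)
  let ?C = "sum_carrier F \<Lambda> E" and ?N = "sum_norm F \<Lambda>" and ?e = "\<lambda>a. (\<lambda>_. 0)(l := a)"
  fix z1 z2 and \<epsilon> :: real
  assume z: "z1 \<in> E l" "z2 \<in> E l" "norm z1 = 1" "norm z2 = 1" and \<epsilon>: "\<epsilon> > 0"
  obtain \<delta> where "0 < \<delta>" "\<delta> \<le> 1 / 4" "4 * \<delta> \<le> \<epsilon>"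
    using small_margin[OF \<epsilon>] by blast
  then have \<delta>: "0 < \<delta>" "\<delta> \<le> 1 / 2" "2 * \<delta> \<le> \<epsilon>"
    by linarith+
  obtain f where f: "f \<in> dual_sphere ?C sum_add sum_scale ?N" "?e z1 \<in> slice ?C ?N f \<delta>"
    and fd: "set_dist sum_add sum_scale ?N (?e z2) (slice ?C ?N f \<delta>)
      + set_dist sum_add sum_scale ?N (?e z2) (sum_scale (-1) ` slice ?C ?N f \<delta>) < 2 + \<delta>"
    using P \<delta>(1) sum_carrier_single[OF sub l] sum_norm_single[OF sub l] z
    unfolding prop_ss_def by (metis (no_types, lifting))
  note g = dual_sphere_restrict_component[OF sub l f(1)]
  have gz1: "1 - \<delta> < f (?e z1)"
    using f(2) by (simp add: slice_def)
  \<comment> \<open>the restriction may have norm below 1; dividing by it only raises its positive values\<close>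
  obtain c where c: "0 < c" "c \<le> 1" and h: "(\<lambda>a. f (?e a) / c) \<in> dual_sphere (E l) (+) scaleR norm"
    using dual_sphere_normalise[where N = norm, OF g z(1)] z(3) gz1 \<delta>(2) by auto
  let ?Sl = "slice (E l) norm (\<lambda>a. f (?e a) / c) \<epsilon>"
  have le_h: "f (?e a) \<le> f (?e a) / c" if "0 \<le> f (?e a)" for a
    using that c by (simp add: le_divide_eq mult_left_le)
  have "z1 \<in> ?Sl"
    using le_h[of z1] gz1 z \<delta> by (simp add: slice_def)
  have retract: "\<exists>s\<in>?Sl. norm (z2 - s) \<le> ?N (\<lambda>k. ?e z2 k - x k) \<and> norm (z2 + s) \<le> ?N (\<lambda>k. ?e z2 k + x k)"
    if "x \<in> slice ?C ?N f \<delta>" for x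
  proof -
    have x: "x \<in> ?C" "?N x \<le> 1" "1 - \<delta> < f x"
      using that by (auto simp: slice_def)
    obtain s where s: "s \<in> E l" "norm s \<le> 1" "f x - 1 + f (?e z1) \<le> f (?e s)"
      "norm (z2 - s) \<le> ?N (\<lambda>k. ?e z2 k - x k)" "norm (z2 + s) \<le> ?N (\<lambda>k. ?e z2 k + x k)"
      using ball_retract_component[OF sub l f(1) z(1,3) z(2) x(1,2)] by blast
    have "1 - 2 * \<delta> < f (?e s)"
      using s(3) x(3) gz1 by linarith
    then have "s \<in> ?Sl"
      using le_h[of s] s(1,2) \<delta> by (simp add: slice_def)
    then show ?thesis
      using s(4,5) by blast
  qed
  have "slice ?C ?N f \<delta> \<noteq> {}"
    using f(2) by blast
  note d = set_dist_le_sum_set_dist[where T = "slice ?C ?N f \<delta>" and S = ?Sl and z = "?e z2", OF this retract]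
  have "set_dist (+) scaleR norm z2 ?Sl + set_dist (+) scaleR norm z2 (scaleR (-1) ` ?Sl) < 2 + \<epsilon>"
    using d fd \<delta> by linarith
  then show "\<exists>h\<in>dual_sphere (E l) (+) scaleR norm. z1 \<in> slice (E l) norm h \<epsilon> \<and>
      set_dist (+) scaleR norm z2 (slice (E l) norm h \<epsilon>)
      + set_dist (+) scaleR norm z2 (scaleR (-1) ` slice (E l) norm h \<epsilon>) < 2 + \<epsilon>"
    using h \<open>z1 \<in> ?Sl\<close> by blast
qed

section \<open>Property (**) passes to c_0 and l_\<infinity> sums\<close>

lemma sup_norm_approx:
  assumes x: "x \<in> sum_carrier F \<Lambda> E" and F: "F \<noteq> L1" and t: "0 \<le> t" "t < sum_norm F \<Lambda> x"
  obtains l where "l \<in> \<Lambda>" "t < norm (x l)"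
proof -
  have "\<exists>v\<in>insert 0 ((\<lambda>l. norm (x l)) ` \<Lambda>). t < v"
    using t(2) less_cSup_iff[of "insert 0 ((\<lambda>l. norm (x l)) ` \<Lambda>)" t]
      sum_carrier_bdd_above[OF x F] sum_norm_sup[OF F, of \<Lambda> x] by simp
  then show ?thesis
    using t(1) that by auto
qed

lemma sup_update_in_slice:
  assumes F: "F \<noteq> L1" and x: "x \<in> sum_carrier F \<Lambda> E" "sum_norm F \<Lambda> x \<le> 1" and l: "l \<in> \<Lambda>"
    and s: "s \<in> slice (E l) norm g \<delta>" and \<delta>: "\<delta> \<le> \<epsilon>"
  shows "x(l := s) \<in> slice (sum_carrier F \<Lambda> E) (sum_norm F \<Lambda>) (\<lambda>x. g (x l)) \<epsilon>"
proof -
  have s': "s \<in> E l" "norm s \<le> 1" "1 - \<delta> < g s"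
    using s by (auto simp: slice_def)
  have "sum_norm F \<Lambda> (x(l := 0)) \<le> sum_norm F \<Lambda> x"
    using sum_norm_update[OF x(1) l, of "x l"] F by simp
  then have "sum_norm F \<Lambda> (x(l := s)) \<le> 1"
    using sum_norm_update[OF x(1) l, of s] F x(2) s'(2) by simp
  then show ?thesis
    using sum_carrier_update[OF x(1) l s'(1)] s'(3) \<delta> by (simp add: slice_def)
qed

lemma sup_slice_set_dist_le:
  assumes sub: "\<forall>k\<in>\<Lambda>. subspace (E k)" and F: "F \<noteq> L1"
    and z: "z \<in> sum_carrier F \<Lambda> E" "sum_norm F \<Lambda> z = 1" and l: "l \<in> \<Lambda>"
    and s: "s \<in> slice (E l) norm g \<delta>" "s' \<in> slice (E l) norm g \<delta>" and \<delta>: "\<delta> \<le> \<epsilon>"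
  defines "S \<equiv> slice (sum_carrier F \<Lambda> E) (sum_norm F \<Lambda>) (\<lambda>x. g (x l)) \<epsilon>"
  shows "set_dist sum_add sum_scale (sum_norm F \<Lambda>) z S
           + set_dist sum_add sum_scale (sum_norm F \<Lambda>) z (sum_scale (-1) ` S)
         \<le> norm (z l - s) + norm (z l + s')"
proof -
  let ?C = "sum_carrier F \<Lambda> E" and ?N = "sum_norm F \<Lambda>"
  have mz: "(\<lambda>k. - z k) \<in> ?C" "?N (\<lambda>k. - z k) \<le> 1"
    using sum_carrier_uminus[OF sub z(1)] sum_norm_cong[of "\<lambda>k. - z k" z] z(2) by auto
  have x: "z(l := s) \<in> S" and x': "(\<lambda>k. - z k)(l := s') \<in> S"
    unfolding S_def using sup_update_in_slice[OF F z(1) _ l s(1) \<delta>] sup_update_in_slice[OF F mz l s(2) \<delta>] z(2)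
    by simp_all
  have "S \<subseteq> ?C"
    by (auto simp: S_def slice_def)
  moreover have "(\<lambda>k. z k - (z(l := s)) k) = (\<lambda>_. 0)(l := z l - s)"
    "(\<lambda>k. z k + ((\<lambda>k. - z k)(l := s')) k) = (\<lambda>_. 0)(l := z l + s')"
    by auto
  ultimately have "set_dist sum_add sum_scale ?N z S \<le> ?N ((\<lambda>_. 0)(l := z l - s))"
    and "set_dist sum_add sum_scale ?N z (sum_scale (-1) ` S) \<le> ?N ((\<lambda>_. 0)(l := z l + s'))"
    using sum_set_dist_le(1)[OF sub z(1) _ x] sum_set_dist_le(2)[OF sub z(1) _ x'] by (simp_all only:)
  then show ?thesis
    using sum_norm_single[OF sub l] by simp
qed

lemma prop_ss_sup_sum:
  assumes sub: "\<forall>k\<in>\<Lambda>. subspace (E k)" and Ps: "\<forall>l\<in>\<Lambda>. prop_ss_sub (E l)" and F: "F \<noteq> L1"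
  shows "prop_ss (sum_carrier F \<Lambda> E) sum_add sum_scale (sum_norm F \<Lambda>)"
  unfolding prop_ss_def
proof (intro ballI impI allI)
  let ?C = "sum_carrier F \<Lambda> E" and ?N = "sum_norm F \<Lambda>"
  fix z1 z2 and \<epsilon> :: real
  assume z: "z1 \<in> ?C" "z2 \<in> ?C" "?N z1 = 1" "?N z2 = 1" and \<epsilon>: "\<epsilon> > 0"
  obtain \<delta> where \<delta>: "0 < \<delta>" "\<delta> \<le> 1 / 4" "4 * \<delta> \<le> \<epsilon>" "1 - \<epsilon> \<le> (1 - \<delta>) * (1 - \<delta>)"
    using small_margin[OF \<epsilon>] by blast
  obtain l where l: "l \<in> \<Lambda>" "1 - \<delta> < norm (z1 l)"
    using sup_norm_approx[OF z(1) F, of "1 - \<delta>"] z(3) \<delta> by auto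
  obtain g v s s' where g: "g \<in> dual_sphere (E l) (+) scaleR norm"
    and s: "s \<in> slice (E l) norm g \<delta>" "s' \<in> slice (E l) norm g \<delta>"
    and gz1: "(1 - \<delta>) * norm (z1 l) \<le> g (z1 l)" and v: "z2 l = norm (z2 l) *\<^sub>R v"
    and ss: "norm (v - s) + norm (v + s') < 2 + \<delta>"
    using prop_ss_sub_witnesses[OF Ps[rule_format, OF l(1)] sub[rule_format, OF l(1)]
        sum_carrier_component[OF z(1) l(1)] sum_carrier_component[OF z(2) l(1)] _ \<delta>(1)] l(2) \<delta>(2)
    by force
  let ?S = "slice ?C ?N (\<lambda>x. g (x l)) \<epsilon>"
  have "(1 - \<delta>) * (1 - \<delta>) < (1 - \<delta>) * norm (z1 l)"
    using l(2) \<delta> by (intro mult_strict_left_mono) auto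
  then have "z1 \<in> ?S"
    using gz1 z(1,3) \<delta>(4) by (simp add: slice_def)
  have "norm (z2 l - s) + norm (z2 l + s') \<le> 2 + \<delta>"
    using norm_scaled_pair_le[of "norm (z2 l)" s s' v \<delta>] v norm_le_sum_norm[OF z(2) l(1)] z(4) s ss \<delta>
    by (simp add: slice_def)
  moreover have "\<delta> \<le> \<epsilon>"
    using \<delta> by linarith
  ultimately have "set_dist sum_add sum_scale ?N z2 ?S + set_dist sum_add sum_scale ?N z2 (sum_scale (-1) ` ?S)
      < 2 + \<epsilon>"
    using sup_slice_set_dist_le[OF sub F z(2,4) l(1) s] \<delta> by fastforce
  then show "\<exists>h\<in>dual_sphere ?C sum_add sum_scale ?N. z1 \<in> slice ?C ?N h \<epsilon> \<and>
      set_dist sum_add sum_scale ?N z2 (slice ?C ?N h \<epsilon>)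
      + set_dist sum_add sum_scale ?N z2 (sum_scale (-1) ` slice ?C ?N h \<epsilon>) < 2 + \<epsilon>"
    using dual_sphere_component[OF sub l(1) g] \<open>z1 \<in> ?S\<close> by blast
qed

section \<open>Property (**) passes to l_1 sums\<close>

lemma weighted_sum_gt_square:
  fixes a b :: "'l \<Rightarrow> real"
  assumes "finite A" "\<And>k. k \<in> A \<Longrightarrow> c * a k \<le> b k" "0 < c" "c < sum a A"
  shows "c * c < sum b A"
proof -
  have "c * c < c * sum a A"
    using assms(3,4) by simp
  also have "\<dots> \<le> sum b A"
    unfolding sum_distrib_left by (rule sum_mono) (rule assms(2))
  finally show ?thesis .
qed

lemma l1_sum_le_norm:
  assumes "x \<in> sum_carrier L1 \<Lambda> E" "finite A" "A \<subseteq> \<Lambda>"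
  shows "(\<Sum>k\<in>A. norm (x k)) \<le> sum_norm L1 \<Lambda> x"
  using l1_norm_split[OF sum_carrier_l1_summable[OF assms(1)] assms(2,3)]
  by (simp add: infsum_nonneg)

lemma l1_mass:
  assumes x: "x \<in> sum_carrier L1 \<Lambda> E" and t: "t < sum_norm L1 \<Lambda> x"
  obtains A where "finite A" "A \<subseteq> {k \<in> \<Lambda>. x k \<noteq> 0}" "t < (\<Sum>k\<in>A. norm (x k))"
proof -
  obtain B where B: "finite B" "B \<subseteq> \<Lambda>"
    "dist (\<Sum>k\<in>B. norm (x k)) (sum_norm L1 \<Lambda> x) \<le> (sum_norm L1 \<Lambda> x - t) / 2"
    using infsum_finite_approximation[OF sum_carrier_l1_summable[OF x], of "(sum_norm L1 \<Lambda> x - t) / 2"] t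
    by (auto simp: sum_norm_def)
  have "(\<Sum>k\<in>B. norm (x k)) = (\<Sum>k\<in>{k \<in> B. x k \<noteq> 0}. norm (x k))"
    using B(1) by (intro sum.mono_neutral_right) auto
  moreover have "t < (\<Sum>k\<in>B. norm (x k))"
    using B(3) t unfolding dist_real_def abs_le_iff by argo
  ultimately show ?thesis
    using that[of "{k \<in> B. x k \<noteq> 0}"] B(1,2) by auto
qed

lemma l1_carrier_finite_support:
  assumes sub: "\<forall>k\<in>\<Lambda>. subspace (E k)" and A: "finite A" "A \<subseteq> \<Lambda>"
    and w: "\<And>k. k \<in> A \<Longrightarrow> w k \<in> E k" "\<And>k. k \<notin> A \<Longrightarrow> w k = 0"
  shows "w \<in> sum_carrier L1 \<Lambda> E"
proof -
  have "(\<lambda>k. norm (w k)) summable_on \<Lambda> \<longleftrightarrow> (\<lambda>k. norm (w k)) summable_on A"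
    using w(2) A(2) by (intro summable_on_cong_neutral) auto
  moreover have "w k \<in> E k" if "k \<in> \<Lambda>" for k
    using w sub that subspace_0 by (cases "k \<in> A") auto
  ultimately show ?thesis
    using A w by (auto simp: sum_carrier_def)
qed

lemma l1_norm_add_finite_support:
  assumes z: "(\<lambda>k. norm (z k)) summable_on \<Lambda>" and A: "finite A" "A \<subseteq> \<Lambda>"
    and w: "\<And>k. k \<notin> A \<Longrightarrow> w k = 0"
  shows "sum_norm L1 \<Lambda> (\<lambda>k. z k + w k) = sum_norm L1 \<Lambda> z + (\<Sum>k\<in>A. norm (z k + w k) - norm (z k))"
proof -
  have "(\<lambda>k. norm (w k)) summable_on \<Lambda>"
    using summable_on_cong_neutral[of A \<Lambda> "\<lambda>k. norm (w k)" "\<lambda>k. norm (w k)"] A w by auto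
  then have "(\<lambda>k. norm (z k) + norm (w k)) summable_on \<Lambda>"
    using z by (rule summable_on_add[rotated])
  then have zw: "(\<lambda>k. norm (z k + w k)) summable_on \<Lambda>"
    by (rule summable_on_comparison_test) (auto intro: norm_triangle_ineq)
  have "infsum (\<lambda>k. norm (z k + w k)) (\<Lambda> - A) = infsum (\<lambda>k. norm (z k)) (\<Lambda> - A)"
    using w by (intro infsum_cong) auto
  then show ?thesis
    using l1_norm_split[OF zw A] l1_norm_split[OF z A] by (simp add: sum_subtractf)
qed

lemma l1_pair_norm_bound:
  assumes z: "z \<in> sum_carrier L1 \<Lambda> E" "sum_norm L1 \<Lambda> z = 1" and A: "finite A" "A \<subseteq> \<Lambda>"
    and pq: "\<And>k. k \<notin> A \<Longrightarrow> p k = 0" "\<And>k. k \<notin> A \<Longrightarrow> q k = 0"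
    and bound: "\<And>k. k \<in> A \<Longrightarrow> norm (z k - p k) + norm (z k + q k) \<le> (2 + \<delta>) * norm (z k)"
    and \<delta>: "0 \<le> \<delta>"
  shows "sum_norm L1 \<Lambda> (\<lambda>k. z k - p k) + sum_norm L1 \<Lambda> (\<lambda>k. z k + q k) \<le> 2 + \<delta>"
proof -
  note s = sum_carrier_l1_summable[OF z(1)]
  have "sum_norm L1 \<Lambda> (\<lambda>k. z k - p k) = 1 + (\<Sum>k\<in>A. norm (z k - p k) - norm (z k))"
    using l1_norm_add_finite_support[OF s A, of "\<lambda>k. - p k"] pq(1) z(2) by simp
  moreover have "sum_norm L1 \<Lambda> (\<lambda>k. z k + q k) = 1 + (\<Sum>k\<in>A. norm (z k + q k) - norm (z k))"
    using l1_norm_add_finite_support[OF s A, of q] pq(2) z(2) by simp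
  moreover have "(\<Sum>k\<in>A. norm (z k - p k) - norm (z k)) + (\<Sum>k\<in>A. norm (z k + q k) - norm (z k))
      \<le> (\<Sum>k\<in>A. \<delta> * norm (z k))"
    unfolding sum.distrib[symmetric] by (rule sum_mono) (use bound in \<open>simp add: algebra_simps\<close>)
  moreover have "(\<Sum>k\<in>A. \<delta> * norm (z k)) \<le> \<delta>"
    using l1_sum_le_norm[OF z(1) A] z(2) \<delta> by (simp add: sum_distrib_left[symmetric] mult_left_le)
  ultimately show ?thesis
    by linarith
qed

lemma l1_common_mass:
  assumes z: "z1 \<in> sum_carrier L1 \<Lambda> E" "z2 \<in> sum_carrier L1 \<Lambda> E"
    "sum_norm L1 \<Lambda> z1 = 1" "sum_norm L1 \<Lambda> z2 = 1" and \<delta>: "0 < \<delta>" "\<delta> \<le> 1"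
  obtains A where "finite A" "A \<noteq> {}" "A \<subseteq> {k \<in> \<Lambda>. z1 k \<noteq> 0 \<or> z2 k \<noteq> 0}"
    "1 - \<delta> < (\<Sum>k\<in>A. norm (z1 k))" "1 - \<delta> < (\<Sum>k\<in>A. norm (z2 k))"
proof -
  have "1 - \<delta> < sum_norm L1 \<Lambda> z1" "1 - \<delta> < sum_norm L1 \<Lambda> z2"
    using z(3,4) \<delta>(1) by simp_all
  then obtain A1 A2 where A1: "finite A1" "A1 \<subseteq> {k \<in> \<Lambda>. z1 k \<noteq> 0}" "1 - \<delta> < (\<Sum>k\<in>A1. norm (z1 k))"
    and A2: "finite A2" "A2 \<subseteq> {k \<in> \<Lambda>. z2 k \<noteq> 0}" "1 - \<delta> < (\<Sum>k\<in>A2. norm (z2 k))"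
    using l1_mass[OF z(1)] l1_mass[OF z(2)] by (metis (no_types, lifting))
  have U: "finite (A1 \<union> A2)"
    using A1(1) A2(1) by blast
  have "(\<Sum>k\<in>A1. norm (z1 k)) \<le> (\<Sum>k\<in>A1 \<union> A2. norm (z1 k))"
    "(\<Sum>k\<in>A2. norm (z2 k)) \<le> (\<Sum>k\<in>A1 \<union> A2. norm (z2 k))"
    by (intro sum_mono2[OF U]; simp)+
  then show ?thesis
    using that[of "A1 \<union> A2"] U A1 A2 \<delta>(2) by fastforce
qed

lemma prop_ss_sub_family_witnesses:
  fixes w1 w2 :: "'l \<Rightarrow> 'b::real_normed_vector"
  assumes "\<And>k. k \<in> A \<Longrightarrow> prop_ss_sub (X k)" "\<And>k. k \<in> A \<Longrightarrow> subspace (X k)"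
    and "\<And>k. k \<in> A \<Longrightarrow> w1 k \<in> X k" "\<And>k. k \<in> A \<Longrightarrow> w2 k \<in> X k"
    and "\<And>k. k \<in> A \<Longrightarrow> w1 k \<noteq> 0 \<or> w2 k \<noteq> 0" and "0 < \<delta>"
  obtains G V S S' where "\<forall>k\<in>A. G k \<in> dual_sphere (X k) (+) scaleR norm
      \<and> S k \<in> slice (X k) norm (G k) \<delta> \<and> S' k \<in> slice (X k) norm (G k) \<delta>
      \<and> (1 - \<delta>) * norm (w1 k) \<le> G k (w1 k) \<and> w2 k = norm (w2 k) *\<^sub>R V k
      \<and> norm (V k - S k) + norm (V k + S' k) < 2 + \<delta>"
proof -
  have "\<forall>k\<in>A. \<exists>g v s s'. g \<in> dual_sphere (X k) (+) scaleR norm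
      \<and> s \<in> slice (X k) norm g \<delta> \<and> s' \<in> slice (X k) norm g \<delta> \<and> (1 - \<delta>) * norm (w1 k) \<le> g (w1 k)
      \<and> w2 k = norm (w2 k) *\<^sub>R v \<and> norm (v - s) + norm (v + s') < 2 + \<delta>"
    using prop_ss_sub_witnesses assms by metis
  then show ?thesis
    using that by metis
qed

lemma dual_sphere_l1_sum:
  assumes sub: "\<forall>k\<in>\<Lambda>. subspace (E k)" and A: "finite A" "A \<noteq> {}" "A \<subseteq> \<Lambda>"
    and G: "\<And>k. k \<in> A \<Longrightarrow> G k \<in> dual_sphere (E k) (+) scaleR norm"
  shows "(\<lambda>x. \<Sum>k\<in>A. G k (x k)) \<in> dual_sphere (sum_carrier L1 \<Lambda> E) sum_add sum_scale (sum_norm L1 \<Lambda>)"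
proof (rule dual_sphereI)
  have comp: "x k \<in> E k" if "x \<in> sum_carrier L1 \<Lambda> E" "k \<in> A" for x k
    using sum_carrier_component[OF that(1)] that(2) A(3) by blast
  show "\<forall>x\<in>sum_carrier L1 \<Lambda> E. \<forall>y\<in>sum_carrier L1 \<Lambda> E.
      (\<Sum>k\<in>A. G k (sum_add x y k)) = (\<Sum>k\<in>A. G k (x k)) + (\<Sum>k\<in>A. G k (y k))"
    using dual_sphere_add[OF G] comp by (simp add: sum_add_def sum.distrib)
  show "\<forall>x\<in>sum_carrier L1 \<Lambda> E. \<forall>c. (\<Sum>k\<in>A. G k (sum_scale c x k)) = c * (\<Sum>k\<in>A. G k (x k))"
    using dual_sphere_scale[OF G] comp by (simp add: sum_scale_def sum_distrib_left)
  show "\<bar>\<Sum>k\<in>A. G k (x k)\<bar> \<le> 1" if "x \<in> sum_carrier L1 \<Lambda> E" "sum_norm L1 \<Lambda> x \<le> 1" for x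
  proof -
    have "\<bar>\<Sum>k\<in>A. G k (x k)\<bar> \<le> (\<Sum>k\<in>A. \<bar>G k (x k)\<bar>)"
      by (rule sum_abs)
    also have "\<dots> \<le> (\<Sum>k\<in>A. norm (x k))"
      using dual_sphere_abs_le_norm[OF G] sub A(3) comp[OF that(1)] by (intro sum_mono) blast
    also have "\<dots> \<le> 1"
      using l1_sum_le_norm[OF that(1) A(1,3)] that(2) by linarith
    finally show ?thesis .
  qed
  show "\<exists>x\<in>sum_carrier L1 \<Lambda> E. sum_norm L1 \<Lambda> x \<le> 1 \<and> t < \<bar>\<Sum>k\<in>A. G k (x k)\<bar>" if t: "t < 1" for t
  proof -
    obtain k0 where k0: "k0 \<in> A"
      using A(2) by blast
    then have "k0 \<in> \<Lambda>" "0 \<in> E k0"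
      using A(3) sub subspace_0 by auto
    then obtain a where a: "a \<in> E k0" "norm a \<le> 1" "t < \<bar>G k0 a\<bar>"
      using dual_sphere_approx[OF G[OF k0] _ _ t, of 0] by auto
    have "G k 0 = 0" if "k \<in> A" for k
      using dual_sphere_scale[OF G[OF that], of 0 0] sub A(3) that subspace_0 by auto
    then have "(\<Sum>k\<in>A. G k (((\<lambda>_. 0)(k0 := a)) k)) = G k0 a"
      using A(1) k0 by (simp add: sum.delta_remove if_distrib)
    then show ?thesis
      using a sum_carrier_single[OF sub \<open>k0 \<in> \<Lambda>\<close> a(1)] sum_norm_single[OF sub \<open>k0 \<in> \<Lambda>\<close>, of L1 a]
      by (intro bexI[of _ "(\<lambda>_. 0)(k0 := a)"]) auto
  qed
qed

lemma l1_weighted_in_slice: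
  assumes sub: "\<forall>k\<in>\<Lambda>. subspace (E k)" and A: "finite A" "A \<subseteq> \<Lambda>"
    and G: "\<And>k. k \<in> A \<Longrightarrow> G k \<in> dual_sphere (E k) (+) scaleR norm"
    and a: "\<And>k. k \<in> A \<Longrightarrow> 0 \<le> a k" "sum a A \<le> 1" "1 - \<delta> < sum a A"
    and t: "\<And>k. k \<in> A \<Longrightarrow> t k \<in> slice (E k) norm (G k) \<delta>"
    and \<delta>: "\<delta> < 1" and \<epsilon>: "1 - \<epsilon> \<le> (1 - \<delta>) * (1 - \<delta>)"
  shows "(\<lambda>k. if k \<in> A then a k *\<^sub>R t k else 0)
           \<in> slice (sum_carrier L1 \<Lambda> E) (sum_norm L1 \<Lambda>) (\<lambda>x. \<Sum>k\<in>A. G k (x k)) \<epsilon>"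
proof -
  let ?w = "\<lambda>k. if k \<in> A then a k *\<^sub>R t k else 0"
  have tk: "t k \<in> E k" "norm (t k) \<le> 1" "1 - \<delta> < G k (t k)" if "k \<in> A" for k
    using t[OF that] by (auto simp: slice_def)
  have "?w \<in> sum_carrier L1 \<Lambda> E"
    using sub A tk by (intro l1_carrier_finite_support[OF sub A]) (auto intro: subspace_scale)
  moreover have "sum_norm L1 \<Lambda> ?w \<le> 1"
  proof -
    have "sum_norm L1 \<Lambda> ?w = (\<Sum>k\<in>A. a k * norm (t k))"
      using l1_norm_add_finite_support[of "\<lambda>_. 0" \<Lambda> A ?w] A a(1)
      by (simp add: sum_norm_def)
    also have "\<dots> \<le> sum a A"
      using a(1) tk(2) by (intro sum_mono) (simp add: mult_left_le)
    finally show ?thesis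
      using a(2) by linarith
  qed
  moreover have "(1 - \<delta>) * (1 - \<delta>) < (\<Sum>k\<in>A. G k (?w k))"
  proof (rule weighted_sum_gt_square[OF A(1) _ _ a(3)])
    show "(1 - \<delta>) * a k \<le> G k (?w k)" if "k \<in> A" for k
      using dual_sphere_scale[OF G[OF that] tk(1)[OF that], of "a k"] tk(3)[OF that] a(1)[OF that] that
      by (simp add: mult.commute mult_left_mono)
  qed (use \<delta> in simp)
  ultimately show ?thesis
    using \<epsilon> by (simp add: slice_def)
qed

lemma prop_ss_l1_sum:
  assumes sub: "\<forall>k\<in>\<Lambda>. subspace (E k)" and Ps: "\<forall>l\<in>\<Lambda>. prop_ss_sub (E l)"
  shows "prop_ss (sum_carrier L1 \<Lambda> E) sum_add sum_scale (sum_norm L1 \<Lambda>)"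
  unfolding prop_ss_def
proof (intro ballI impI allI)
  let ?C = "sum_carrier L1 \<Lambda> E" and ?N = "sum_norm L1 \<Lambda>"
  fix z1 z2 and \<epsilon> :: real
  assume z: "z1 \<in> ?C" "z2 \<in> ?C" "?N z1 = 1" "?N z2 = 1" and \<epsilon>: "\<epsilon> > 0"
  obtain \<delta> where \<delta>: "0 < \<delta>" "\<delta> \<le> 1 / 4" "4 * \<delta> \<le> \<epsilon>" and sq: "1 - \<epsilon> \<le> (1 - \<delta>) * (1 - \<delta>)"
    using small_margin[OF \<epsilon>] by blast
  have "\<delta> \<le> 1"
    using \<delta>(2) by simp
  then obtain A where "finite A" "A \<noteq> {}" "A \<subseteq> {k \<in> \<Lambda>. z1 k \<noteq> 0 \<or> z2 k \<noteq> 0}"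
    and mass: "1 - \<delta> < (\<Sum>k\<in>A. norm (z1 k))" "1 - \<delta> < (\<Sum>k\<in>A. norm (z2 k))"
    by (rule l1_common_mass[OF z \<delta>(1)])
  then have A: "finite A" "A \<subseteq> \<Lambda>" "A \<noteq> {}" and nz: "\<And>k. k \<in> A \<Longrightarrow> z1 k \<noteq> 0 \<or> z2 k \<noteq> 0"
    by auto
  have "k \<in> \<Lambda>" if "k \<in> A" for k
    using A(2) that by blast
  then have "\<And>k. k \<in> A \<Longrightarrow> prop_ss_sub (E k)" "\<And>k. k \<in> A \<Longrightarrow> subspace (E k)"
    "\<And>k. k \<in> A \<Longrightarrow> z1 k \<in> E k" "\<And>k. k \<in> A \<Longrightarrow> z2 k \<in> E k"
    using Ps sub sum_carrier_component[OF z(1)] sum_carrier_component[OF z(2)] by simp_all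
  then obtain G V SA SB where "\<forall>k\<in>A. G k \<in> dual_sphere (E k) (+) scaleR norm
      \<and> SA k \<in> slice (E k) norm (G k) \<delta> \<and> SB k \<in> slice (E k) norm (G k) \<delta>
      \<and> (1 - \<delta>) * norm (z1 k) \<le> G k (z1 k) \<and> z2 k = norm (z2 k) *\<^sub>R V k
      \<and> norm (V k - SA k) + norm (V k + SB k) < 2 + \<delta>"
    by (rule prop_ss_sub_family_witnesses[OF _ _ _ _ nz \<delta>(1)])
  then have G: "\<And>k. k \<in> A \<Longrightarrow> G k \<in> dual_sphere (E k) (+) scaleR norm"
    and SA: "\<And>k. k \<in> A \<Longrightarrow> SA k \<in> slice (E k) norm (G k) \<delta>"
    and SB: "\<And>k. k \<in> A \<Longrightarrow> SB k \<in> slice (E k) norm (G k) \<delta>"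
    and Gz1: "\<And>k. k \<in> A \<Longrightarrow> (1 - \<delta>) * norm (z1 k) \<le> G k (z1 k)"
    and V: "\<And>k. k \<in> A \<Longrightarrow> z2 k = norm (z2 k) *\<^sub>R V k"
    and VS: "\<And>k. k \<in> A \<Longrightarrow> norm (V k - SA k) + norm (V k + SB k) < 2 + \<delta>"
    by auto
  let ?S = "slice ?C ?N (\<lambda>x. \<Sum>k\<in>A. G k (x k)) \<epsilon>"
  have "z1 \<in> ?S"
    using weighted_sum_gt_square[OF A(1) Gz1 _ mass(1)] z(1,3) \<delta> sq by (simp add: slice_def)
  define x where "x k = (if k \<in> A then norm (z2 k) *\<^sub>R SA k else 0)" for k
  define x' where "x' k = (if k \<in> A then norm (z2 k) *\<^sub>R SB k else 0)" for k
  have sum_z2: "(\<Sum>k\<in>A. norm (z2 k)) \<le> 1"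
    using l1_sum_le_norm[OF z(2) A(1,2)] z(4) by simp
  have "x \<in> ?S" "x' \<in> ?S"
    unfolding x_def x'_def using \<delta> sq sum_z2 mass(2) SA SB
    by (auto intro!: l1_weighted_in_slice[OF sub A(1,2) G])
  have "?N (\<lambda>k. z2 k - x k) + ?N (\<lambda>k. z2 k + x' k) \<le> 2 + \<delta>"
  proof (rule l1_pair_norm_bound[OF z(2,4) A(1,2)])
    show "norm (z2 k - x k) + norm (z2 k + x' k) \<le> (2 + \<delta>) * norm (z2 k)" if "k \<in> A" for k
    proof -
      have "z2 k - x k = norm (z2 k) *\<^sub>R (V k - SA k)" "z2 k + x' k = norm (z2 k) *\<^sub>R (V k + SB k)"
        using V[OF that] that by (simp_all add: x_def x'_def algebra_simps)
      then show ?thesis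
        using mult_left_mono[OF less_imp_le[OF VS[OF that]] norm_ge_zero[of "z2 k"]]
        by (simp add: mult.commute distrib_left[symmetric])
    qed
  qed (use \<delta> in \<open>auto simp: x_def x'_def\<close>)
  moreover have "?S \<subseteq> ?C"
    by (auto simp: slice_def)
  ultimately have "set_dist sum_add sum_scale ?N z2 ?S + set_dist sum_add sum_scale ?N z2 (sum_scale (-1) ` ?S)
      < 2 + \<epsilon>"
    using sum_set_dist_le(1)[OF sub z(2) _ \<open>x \<in> ?S\<close>] sum_set_dist_le(2)[OF sub z(2) _ \<open>x' \<in> ?S\<close>] \<delta>
    by fastforce
  then show "\<exists>h\<in>dual_sphere ?C sum_add sum_scale ?N. z1 \<in> slice ?C ?N h \<epsilon> \<and>
      set_dist sum_add sum_scale ?N z2 (slice ?C ?N h \<epsilon>)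
      + set_dist sum_add sum_scale ?N z2 (sum_scale (-1) ` slice ?C ?N h \<epsilon>) < 2 + \<epsilon>"
    using dual_sphere_l1_sum[OF sub A(1,3,2) G] \<open>z1 \<in> ?S\<close> by blast
qed

theorem proposition2p6:
  fixes E :: "'l \<Rightarrow> 'b::banach set" and \<Lambda> :: "'l set" and F :: sum_kind
  assumes "\<forall>l\<in>\<Lambda>. subspace (E l) \<and> closed (E l)"
  shows "prop_ss (sum_carrier F \<Lambda> E) sum_add sum_scale (sum_norm F \<Lambda>)
           \<longleftrightarrow> (\<forall>l\<in>\<Lambda>. prop_ss_sub (E l))"
proof -
  have sub: "\<forall>k\<in>\<Lambda>. subspace (E k)"
    using assms by blast
  show ?thesis
  proof
    assume "prop_ss (sum_carrier F \<Lambda> E) sum_add sum_scale (sum_norm F \<Lambda>)"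
    then show "\<forall>l\<in>\<Lambda>. prop_ss_sub (E l)"
      using prop_ss_summand[OF sub] by blast
  next
    assume "\<forall>l\<in>\<Lambda>. prop_ss_sub (E l)"
    then show "prop_ss (sum_carrier F \<Lambda> E) sum_add sum_scale (sum_norm F \<Lambda>)"
      using prop_ss_l1_sum[OF sub] prop_ss_sup_sum[OF sub] by (cases "F = L1") auto
  qed
qed

end
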